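(* Let $\mathbb{K}=\mathbb{R}$ or $\mathbb{C}$ and let $f,g:(\mathbb{K}^n,0)\to(\mathbb{K},0)$ be finitely determined smooth function germs. If $f$ and $g$ are bi-Lipschitz equivalent, then the corank of $f$ at $0$ is equal to the corank of $g$ at $0$.
   Context: "Smooth" means $C^\infty$ if $\mathbb{K}=\mathbb{R}$ and holomorphic if $\mathbb{K}=\mathbb{C}$. The corank of $f$ at $0$ is the dimension of the kernel of the Hessian matrix $\left(\frac{\partial^2 f}{\partial x_i\partial x_j}(0)\right)$. Two smooth germs are smoothly equivalent if one is obtained from the other by composition on the right with a smooth diffeomorphism germ of $(\mathbb{K}^n,0)$ (biholomorphic if $\mathbb{K}=\mathbb{C}$). A germ $f$ vanishing at $0$ is $k$-determined if every smooth germ vanishing at $0$ with the same $k$-jet at $0$ as $f$ is smoothly equivalent to $f$; it is finitely determined if it is $k$-determined for some $k\in\mathbb{N}$. Two function germs $f,g:(\mathbb{K}^n,0)\to(\mathbb{K},0)$ are bi-Lipschitz equivalent if there is a germ of bi-Lipschitz homeomorphism $\varphi:(\mathbb{K}^n,0)\to(\mathbb{K}^n,0)$ (that is, $\frac1L\|x-y\|\le\|\varphi(x)-\varphi(y)\|\le L\|x-y\|$ near $0$ for some $L>0$) such that $f\circ\varphi=g$.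
   Formalization: The formal theorem also assumes that f is critical at 0 (all first partial derivatives vanish); without this the claim fails: for n=1, f=x and g=x+x² are 1-determined and bi-Lipschitz equivalent but have coranks 1 and 0. *)

theory Defs
  imports "HOL-Analysis.Analysis"
begin

text \<open>
  Germs at \<open>0\<close> are represented by total functions on \<open>'k^'n\<close> of which only the values near \<open>0\<close>
  matter: identities between germs are required \<^term>\<open>eventually\<close> in \<open>nhds 0\<close>.
\<close>

definition partial_deriv ::
    "'n \<Rightarrow> ('k::real_normed_field ^ 'n::finite \<Rightarrow> 'k) \<Rightarrow> 'k ^ 'n \<Rightarrow> 'k" where
  "partial_deriv i f x = deriv (\<lambda>t. f (x + axis i t)) 0"

text \<open>\<open>partial_derivs [i, j, \<dots>] f\<close> is \<open>\<partial>\<^sub>i (\<partial>\<^sub>j (\<dots> f))\<close>; the list is a sequence of coordinate directions.\<close>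

definition partial_derivs ::
    "'n list \<Rightarrow> ('k::real_normed_field ^ 'n::finite \<Rightarrow> 'k) \<Rightarrow> 'k ^ 'n \<Rightarrow> 'k" where
  "partial_derivs is f = foldr partial_deriv is f"

text \<open>
  Over the reals: all iterated partial derivatives exist and are continuous on one neighbourhood
  of \<open>0\<close>. Existence is stated separately because \<^const>\<open>deriv\<close> is total.
\<close>

definition smooth_germ :: "(real ^ 'n::finite \<Rightarrow> real) \<Rightarrow> bool" where
  "smooth_germ f \<longleftrightarrow> (\<exists>U. open U \<and> 0 \<in> U \<and>
     (\<forall>is. continuous_on U (partial_derivs is f) \<and>
        (\<forall>x\<in>U. \<forall>i. (\<lambda>t. partial_derivs is f (x + axis i t)) field_differentiable at 0)))"

text \<open>Over the complex numbers: a complex-linear Frechet derivative exists at each point near \<open>0\<close>.\<close>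

definition holomorphic_germ :: "(complex ^ 'n::finite \<Rightarrow> complex) \<Rightarrow> bool" where
  "holomorphic_germ f \<longleftrightarrow> (\<exists>U. open U \<and> 0 \<in> U \<and>
     (\<forall>x\<in>U. \<exists>D. (f has_derivative D) (at x) \<and> (\<forall>c h. D (c *s h) = c * D h)))"

text \<open>
  The parameter \<open>S\<close> below is the notion of smoothness of scalar germs: \<^const>\<open>smooth_germ\<close> for the reals
  and \<^const>\<open>holomorphic_germ\<close> for the complex numbers. A vector-valued germ is smooth when its
  components are.
\<close>

definition diffeo_germ ::
    "(('k::real_normed_field ^ 'n::finite \<Rightarrow> 'k) \<Rightarrow> bool) \<Rightarrow> ('k ^ 'n \<Rightarrow> 'k ^ 'n) \<Rightarrow> bool" where
  "diffeo_germ S \<phi> \<longleftrightarrow> \<phi> 0 = 0 \<and> (\<forall>i. S (\<lambda>x. \<phi> x $ i)) \<and>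
     (\<exists>\<psi>. \<psi> 0 = 0 \<and> (\<forall>i. S (\<lambda>x. \<psi> x $ i)) \<and>
        (\<forall>\<^sub>F x in nhds 0. \<psi> (\<phi> x) = x) \<and> (\<forall>\<^sub>F x in nhds 0. \<phi> (\<psi> x) = x))"

definition smoothly_equivalent ::
    "(('k::real_normed_field ^ 'n::finite \<Rightarrow> 'k) \<Rightarrow> bool) \<Rightarrow> ('k ^ 'n \<Rightarrow> 'k) \<Rightarrow> ('k ^ 'n \<Rightarrow> 'k) \<Rightarrow> bool"
  where
  "smoothly_equivalent S f g \<longleftrightarrow> (\<exists>\<phi>. diffeo_germ S \<phi> \<and> (\<forall>\<^sub>F x in nhds 0. f (\<phi> x) = g x))"

definition same_jet ::
    "nat \<Rightarrow> ('k::real_normed_field ^ 'n::finite \<Rightarrow> 'k) \<Rightarrow> ('k ^ 'n \<Rightarrow> 'k) \<Rightarrow> bool" where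
  "same_jet k f g \<longleftrightarrow>
     (\<forall>is. length is \<le> k \<longrightarrow> partial_derivs is f 0 = partial_derivs is g 0)"

definition k_determined ::
    "(('k::real_normed_field ^ 'n::finite \<Rightarrow> 'k) \<Rightarrow> bool) \<Rightarrow> nat \<Rightarrow> ('k ^ 'n \<Rightarrow> 'k) \<Rightarrow> bool" where
  "k_determined S k f \<longleftrightarrow>
     (\<forall>g. S g \<and> g 0 = 0 \<and> same_jet k f g \<longrightarrow> smoothly_equivalent S f g)"

definition finitely_determined ::
    "(('k::real_normed_field ^ 'n::finite \<Rightarrow> 'k) \<Rightarrow> bool) \<Rightarrow> ('k ^ 'n \<Rightarrow> 'k) \<Rightarrow> bool" where
  "finitely_determined S f \<longleftrightarrow> (\<exists>k. k_determined S k f)"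

definition bilipschitz_homeo_germ ::
    "('a::real_normed_vector \<Rightarrow> 'a) \<Rightarrow> bool" where
  "bilipschitz_homeo_germ \<phi> \<longleftrightarrow> \<phi> 0 = 0 \<and>
     (\<exists>U V \<psi>. open U \<and> open V \<and> 0 \<in> U \<and> 0 \<in> V \<and> homeomorphism U V \<phi> \<psi> \<and>
        (\<exists>L>0. \<forall>x\<in>U. \<forall>y\<in>U.
           1 / L * norm (x - y) \<le> norm (\<phi> x - \<phi> y) \<and> norm (\<phi> x - \<phi> y) \<le> L * norm (x - y)))"

definition bilipschitz_equivalent ::
    "('a::real_normed_vector \<Rightarrow> 'b) \<Rightarrow> ('a \<Rightarrow> 'b) \<Rightarrow> bool" where
  "bilipschitz_equivalent f g \<longleftrightarrow>
     (\<exists>\<phi>. bilipschitz_homeo_germ \<phi> \<and> (\<forall>\<^sub>F x in nhds 0. f (\<phi> x) = g x))"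

text \<open>
  The Hessian is invariantly meaningful only at a critical point: in one variable \<open>x\<close> and \<open>x + x\<^sup>2\<close>
  are smoothly equivalent (and 1-determined), yet the kernels of their Hessians have dimensions
  1 and 0.
\<close>

definition critical_at_0 :: "('k::real_normed_field ^ 'n::finite \<Rightarrow> 'k) \<Rightarrow> bool" where
  "critical_at_0 f \<longleftrightarrow> (\<forall>i. partial_deriv i f 0 = 0)"

definition hessian :: "('k::real_normed_field ^ 'n::finite \<Rightarrow> 'k) \<Rightarrow> 'k ^ 'n ^ 'n" where
  "hessian f = (\<chi> i j. partial_deriv i (partial_deriv j f) 0)"

text \<open>The dimension is over \<open>'k\<close>, not over the reals.\<close>

definition corank :: "('k::real_normed_field ^ 'n::finite \<Rightarrow> 'k) \<Rightarrow> nat" where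
  "corank f = vec.dim {v. hessian f *v v = 0}"

end

theory Submission
  imports Defs "HOL-Complex_Analysis.Great_Picard"
begin

text \<open>
  Let \<open>f \<circ> \<phi> = g\<close> with \<open>\<phi>\<close> bi-Lipschitz. Since \<open>f\<close> is critical, \<open>g\<close> is \<open>O(|x|\<^sup>2)\<close>, hence critical. The
  rescalings \<open>x \<mapsto> m \<phi>(x / m)\<close> are equi-bi-Lipschitz, so by Arzela-Ascoli a subsequence converges on
  the unit ball to a bi-Lipschitz map \<open>\<Phi>\<close>, which transports the Hessian quadratic form of \<open>f\<close> to that of
  \<open>g\<close>. A point \<open>x\<close> lies in the kernel of a quadratic form \<open>Q\<close> iff \<open>|Q y - Q x| \<le> C |y - x|\<^sup>2\<close> near \<open>x\<close>.
  As \<open>\<Phi>\<close> is open, it maps the kernel for \<open>g\<close> into the kernel for \<open>f\<close>; it is injective there, so invariance of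
  dimension compares the two, and exchanging \<open>f\<close> and \<open>g\<close> gives equality.
\<close>

subsection \<open>Quadratic forms and blow-up\<close>

text \<open>The second-order Taylor condition f(x) = B(x,x)/2 + o(|x|^2), with \<open>B\<close>
  bilinear over the reals. Real and complex germs both enter the blow-up argument in this
  form.\<close>

definition quad_approx ::
    "('a::euclidean_space \<Rightarrow> 'b::euclidean_space) \<Rightarrow> ('a \<Rightarrow> 'a \<Rightarrow> 'b) \<Rightarrow> bool" where
  "quad_approx f B \<longleftrightarrow> bounded_bilinear B \<and> (\<forall>x y. B x y = B y x) \<and>
     (\<forall>e>0. \<exists>d>0. \<forall>x. norm x < d \<longrightarrow> norm (f x - B x x /\<^sub>R 2) \<le> e * (norm x)\<^sup>2)"

definition radical :: "('a \<Rightarrow> 'a \<Rightarrow> 'b::zero) \<Rightarrow> 'a set" where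
  "radical B = {v. \<forall>w. B v w = 0}"

lemma subspace_radical:
  assumes "bounded_bilinear B"
  shows "subspace (radical B)"
proof -
  interpret bounded_bilinear B by (rule assms)
  show ?thesis
    unfolding subspace_def radical_def by (simp add: zero_left add_left scaleR_left)
qed

text \<open>Quadratic forms are homogeneous of degree 2, so the remainder at
  \<open>x n /\<^sub>R m n\<close>, multiplied by the square of \<open>m n\<close>, is still small
  relative to |x n|^2. The point may vary with \<open>n\<close>, as it does when \<open>f\<close> is
  evaluated along rescaled maps.\<close>

lemma quad_approx_rescaled_limit:
  fixes f :: "'a::euclidean_space \<Rightarrow> 'b::euclidean_space" and m :: "nat \<Rightarrow> real"
  assumes f: "quad_approx f B" and m: "filterlim m at_top sequentially"
    and x: "\<And>n. norm (x n) \<le> M"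
  shows "(\<lambda>n. (m n)\<^sup>2 *\<^sub>R f (x n /\<^sub>R m n) - B (x n) (x n) /\<^sub>R 2) \<longlonglongrightarrow> 0"
proof (rule tendstoI)
  fix e :: real assume e: "e > 0"
  interpret bounded_bilinear B using f by (simp add: quad_approx_def)
  have M: "M \<ge> 0" using x[of 0] norm_ge_zero order_trans by blast
  \<comment> \<open>The summand 1 keeps the denominator positive for \<open>M = 0\<close> and makes
    the final bound strict.\<close>
  define e' where "e' = e / (2 * (M\<^sup>2 + 1))"
  have M1: "M\<^sup>2 + 1 > 0" by (meson add_nonneg_pos zero_le_power2 zero_less_one)
  have e': "e' > 0" using e M1 by (simp add: e'_def)
  then obtain d where d: "d > 0" "\<And>x. norm x < d \<Longrightarrow> norm (f x - B x x /\<^sub>R 2) \<le> e' * (norm x)\<^sup>2"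
    using f unfolding quad_approx_def by meson
  \<comment> \<open>Beyond this threshold \<open>m n\<close> is positive and the rescaled point has
    norm below \<open>d\<close>, also for \<open>M = 0\<close>.\<close>
  have "eventually (\<lambda>n. m n \<ge> (M + 1) / d) sequentially"
    using m by (simp add: filterlim_at_top)
  then show "\<forall>\<^sub>F n in sequentially. dist ((m n)\<^sup>2 *\<^sub>R f (x n /\<^sub>R m n) - B (x n) (x n) /\<^sub>R 2) 0 < e"
  proof eventually_elim
    case (elim n)
    have pos: "(M + 1) / d > 0" using M d by simp
    then have mp: "m n > 0" using elim by linarith
    have "M < m n * d" using elim d(1) by (simp add: field_simps)
    then have small: "norm (x n /\<^sub>R m n) < d"
      using x[of n] mp by (simp add: divide_simps mult.commute)
    have eq: "(m n)\<^sup>2 *\<^sub>R f (x n /\<^sub>R m n) - B (x n) (x n) /\<^sub>R 2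
       = (m n)\<^sup>2 *\<^sub>R (f (x n /\<^sub>R m n) - B (x n /\<^sub>R m n) (x n /\<^sub>R m n) /\<^sub>R 2)"
      using mp by (simp add: scaleR_left scaleR_right scaleR_diff_right power2_eq_square field_simps)
    have "norm ((m n)\<^sup>2 *\<^sub>R f (x n /\<^sub>R m n) - B (x n) (x n) /\<^sub>R 2)
       = (m n)\<^sup>2 * norm (f (x n /\<^sub>R m n) - B (x n /\<^sub>R m n) (x n /\<^sub>R m n) /\<^sub>R 2)"
      unfolding eq by simp
    also have "\<dots> \<le> (m n)\<^sup>2 * (e' * (norm (x n /\<^sub>R m n))\<^sup>2)"
      using d(2)[OF small] by (intro mult_left_mono) auto
    also have "\<dots> = e' * (norm (x n))\<^sup>2"
      using mp by (simp add: power_mult_distrib field_simps)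
    also have "\<dots> \<le> e' * M\<^sup>2"
      using x[of n] e' by (intro mult_left_mono power_mono) auto
    also have "\<dots> < e"
      using e M1 unfolding e'_def by (simp add: field_simps) (smt (verit) M1 zero_le_power2 mult_nonneg_nonneg)
    finally show ?case by simp
  qed
qed

section \<open>Bi-Lipschitz maps and their blow-up at the origin\<close>

definition bilip_on :: "real \<Rightarrow> 'a set \<Rightarrow> ('a::real_normed_vector \<Rightarrow> 'a) \<Rightarrow> bool" where
  "bilip_on L S \<phi> \<longleftrightarrow> L > 0 \<and> (\<forall>x\<in>S. \<forall>y\<in>S.
     norm (x - y) \<le> L * norm (\<phi> x - \<phi> y) \<and> norm (\<phi> x - \<phi> y) \<le> L * norm (x - y))"

lemma bilip_onD:
  assumes "bilip_on L S \<phi>" "x \<in> S" "y \<in> S"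
  shows "norm (x - y) \<le> L * norm (\<phi> x - \<phi> y)" "norm (\<phi> x - \<phi> y) \<le> L * norm (x - y)"
  using assms by (auto simp: bilip_on_def)

lemma bilip_on_inj: "bilip_on L S \<phi> \<Longrightarrow> inj_on \<phi> S"
  by (rule inj_onI) (use bilip_onD(1) in fastforce)

lemma bilip_on_continuous: "bilip_on L S \<phi> \<Longrightarrow> continuous_on S \<phi>"
  by (intro lipschitz_on_continuous_on[of L] lipschitz_onI)
    (auto simp: bilip_on_def dist_norm)

text \<open>As \<phi> need not be differentiable at 0, a subsequential limit \<Phi> of its
  rescalings replaces the derivative. The rescalings keep the constant \<open>L\<close>, and both
  bi-Lipschitz inequalities survive pointwise limits.\<close>

lemma bilip_blow_up:
  fixes f g :: "'a::euclidean_space \<Rightarrow> 'b::euclidean_space"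
  assumes f: "quad_approx f B" and g: "quad_approx g C"
    and \<phi>: "bilip_on L (ball 0 r) \<phi>" "\<phi> 0 = 0" and r: "r > 0"
    and fg: "\<And>x. x \<in> ball 0 r \<Longrightarrow> f (\<phi> x) = g x"
  obtains \<Phi> where "bilip_on L (cball 0 1) \<Phi>" "\<And>x. x \<in> cball 0 1 \<Longrightarrow> B (\<Phi> x) (\<Phi> x) = C x x"
proof -
  \<comment> \<open>Starting the scaling factors at \<open>N\<close> brings the rescaled closed unit
    ball into \<open>ball 0 r\<close> for every \<open>n\<close>.\<close>
  obtain N :: nat where N: "1 / r < real N" using reals_Archimedean2 by blast
  have L: "L > 0" using \<phi> by (simp add: bilip_on_def)
  have Npos: "real N > 0" using N r by (smt (verit) divide_pos_pos)
  define F where "F n x = real (N + n) *\<^sub>R \<phi> (x /\<^sub>R real (N + n))" for n x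
  have in_ball: "x /\<^sub>R real (N + n) \<in> ball 0 r" if "x \<in> cball 0 1" for x :: 'a and n
  proof -
    have "1 < r * real N" using N r by (simp add: field_simps)
    also have "\<dots> \<le> r * real (N + n)" using r by simp
    finally have "norm x < r * real (N + n)" using that by simp
    then show ?thesis using Npos by (simp add: field_simps)
  qed
  have Fbl: "bilip_on L (cball 0 1) (F n)" for n
    unfolding bilip_on_def
  proof (intro conjI ballI)
    fix x y :: 'a assume xy: "x \<in> cball 0 1" "y \<in> cball 0 1"
    let ?m = "real (N + n)"
    have m: "?m > 0" using Npos by simp
    have e1: "norm (F n x - F n y) = ?m * norm (\<phi> (x /\<^sub>R ?m) - \<phi> (y /\<^sub>R ?m))"
      unfolding F_def scaleR_diff_right[symmetric] using m by simp
    have e2: "norm (x - y) = ?m * norm (x /\<^sub>R ?m - y /\<^sub>R ?m)"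
      unfolding scaleR_diff_right[symmetric] using m by simp
    show "norm (x - y) \<le> L * norm (F n x - F n y)" "norm (F n x - F n y) \<le> L * norm (x - y)"
      unfolding e1 e2
      using bilip_onD[OF \<phi>(1) in_ball[OF xy(1), of n] in_ball[OF xy(2), of n]] m
      by (metis mult.left_commute mult_le_cancel_left_pos)+
  qed (rule L)
  have F0: "F n 0 = 0" for n by (simp add: F_def \<phi>)
  have Fb: "norm (F n x) \<le> L" if "x \<in> cball 0 1" for n x
  proof -
    have "norm (F n x) \<le> L * norm x" using bilip_onD(2)[OF Fbl[of n] that, of 0] F0 by simp
    also have "\<dots> \<le> L" using that L by simp
    finally show ?thesis .
  qed
  obtain \<Phi> k where "strict_mono (k :: nat \<Rightarrow> nat)" and
    conv: "\<And>e. 0 < e \<Longrightarrow> \<exists>N. \<forall>n x. n \<ge> N \<and> x \<in> cball 0 1 \<longrightarrow> norm (F (k n) x - \<Phi> x) < e"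
  proof (rule Arzela_Ascoli[of "cball 0 1" F L])
    fix x :: 'a and e :: real assume x: "x \<in> cball 0 1" and e: "0 < e"
    show "\<exists>d>0. \<forall>n y. y \<in> cball 0 1 \<and> norm (x - y) < d \<longrightarrow> norm (F n x - F n y) < e"
    proof (intro exI[of _ "e / L"] conjI allI impI)
      fix n y assume y: "y \<in> cball 0 1 \<and> norm (x - y) < e / L"
      then have "L * norm (x - y) < e" using L by (simp add: field_simps)
      then show "norm (F n x - F n y) < e"
        using bilip_onD(2)[OF Fbl[of n] x, of y] y by linarith
    qed (use e L in simp)
  qed (use Fb in auto)
  have lim: "(\<lambda>n. F (k n) x) \<longlonglongrightarrow> \<Phi> x" if "x \<in> cball 0 1" for x
    using conv that by (intro LIMSEQ_I) blast
  show thesis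
  proof (rule that[of \<Phi>])
    show "bilip_on L (cball 0 1) \<Phi>"
      unfolding bilip_on_def
    proof (intro conjI ballI)
      fix x y :: 'a assume xy: "x \<in> cball 0 1" "y \<in> cball 0 1"
      have l: "(\<lambda>n. norm (F (k n) x - F (k n) y)) \<longlonglongrightarrow> norm (\<Phi> x - \<Phi> y)"
        by (intro tendsto_intros lim xy)
      show "norm (\<Phi> x - \<Phi> y) \<le> L * norm (x - y)"
        by (rule LIMSEQ_le_const2[OF l]) (use bilip_onD(2)[OF Fbl xy] in blast)
      have l: "(\<lambda>n. L * norm (F (k n) x - F (k n) y)) \<longlonglongrightarrow> L * norm (\<Phi> x - \<Phi> y)"
        by (intro tendsto_intros lim xy)
      show "norm (x - y) \<le> L * norm (\<Phi> x - \<Phi> y)"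
        by (rule LIMSEQ_le_const[OF l]) (use bilip_onD(1)[OF Fbl xy] in blast)
    qed (rule L)
  next
    fix x :: 'a assume x: "x \<in> cball 0 1"
    define m where "m n = real (N + k n)" for n
    have mlim: "filterlim m at_top sequentially"
      unfolding m_def
      by (intro filterlim_compose[OF filterlim_real_sequentially]
            filterlim_at_top_mono[OF filterlim_subseq[OF \<open>strict_mono k\<close>]]) auto
    have mpos: "m n > 0" for n using Npos by (simp add: m_def)
    have l1: "(\<lambda>n. (m n)\<^sup>2 *\<^sub>R f (F (k n) x /\<^sub>R m n) - B (F (k n) x) (F (k n) x) /\<^sub>R 2) \<longlonglongrightarrow> 0"
      by (rule quad_approx_rescaled_limit[OF f mlim Fb[OF x]])
    have l2: "(\<lambda>n. (m n)\<^sup>2 *\<^sub>R g (x /\<^sub>R m n) - C x x /\<^sub>R 2) \<longlonglongrightarrow> 0"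
      by (rule quad_approx_rescaled_limit[OF g mlim order_refl])
    have eq: "f (F (k n) x /\<^sub>R m n) = g (x /\<^sub>R m n)" for n
      using fg[OF in_ball[OF x, of "k n"]] mpos[of n] by (simp add: F_def m_def)
    \<comment> \<open>By \<open>eq\<close> the values of \<open>f\<close> and \<open>g\<close>
      cancel; only the difference of the two forms remains.\<close>
    have l3: "(\<lambda>n. C x x /\<^sub>R 2 - B (F (k n) x) (F (k n) x) /\<^sub>R 2) \<longlonglongrightarrow> 0"
      using tendsto_diff[OF l1 l2] by (simp add: eq)
    interpret bounded_bilinear B using f by (simp add: quad_approx_def)
    have "(\<lambda>n. C x x /\<^sub>R 2 - B (F (k n) x) (F (k n) x) /\<^sub>R 2) \<longlonglongrightarrow> C x x /\<^sub>R 2 - B (\<Phi> x) (\<Phi> x) /\<^sub>R 2"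
      by (intro tendsto_intros tendsto lim x)
    with l3 have "C x x /\<^sub>R 2 - B (\<Phi> x) (\<Phi> x) /\<^sub>R 2 = 0"
      using LIMSEQ_unique by blast
    then show "B (\<Phi> x) (\<Phi> x) = C x x" by simp
  qed
qed

section \<open>Bi-Lipschitz invariance of the dimension of the radical\<close>

text \<open>The increment along t w is 2t B(v,w) + t^2 B(w,w). Being O(t^2), it has no linear term:
  divide by t and let t decrease to 0.\<close>

lemma radical_if_quadratic_increment:
  fixes B :: "'a::euclidean_space \<Rightarrow> 'a \<Rightarrow> 'b::euclidean_space"
  assumes B: "bounded_bilinear B" "\<And>x y. B x y = B y x" and d: "d > 0"
    and bound: "\<And>w. norm w < d \<Longrightarrow> norm (B (v + w) (v + w) - B v v) \<le> K * (norm w)\<^sup>2"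
  shows "v \<in> radical B"
proof -
  interpret bounded_bilinear B by (rule B(1))
  obtain M where M: "\<And>a b. norm (B a b) \<le> norm a * norm b * M" using bounded by blast
  have "B v w = 0" for w
  proof -
    have lin: "2 * norm (B v w) \<le> t * ((K + M) * (norm w)\<^sup>2)" if t: "0 < t" "t * norm w < d" for t
    proof -
      have "B (v + t *\<^sub>R w) (v + t *\<^sub>R w) - B v v = t *\<^sub>R (2 *\<^sub>R B v w + t *\<^sub>R B w w)"
        by (simp add: add_left add_right scaleR_left scaleR_right B(2)[of w v] algebra_simps scaleR_2)
      then have "norm (t *\<^sub>R (2 *\<^sub>R B v w + t *\<^sub>R B w w)) \<le> K * (norm (t *\<^sub>R w))\<^sup>2"
        using bound[of "t *\<^sub>R w"] t by simp
      then have "t * norm (2 *\<^sub>R B v w + t *\<^sub>R B w w) \<le> t * (t * (K * (norm w)\<^sup>2))"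
        unfolding norm_scaleR using t by (simp add: power_mult_distrib power2_eq_square mult_ac)
      then have 1: "norm (2 *\<^sub>R B v w + t *\<^sub>R B w w) \<le> t * (K * (norm w)\<^sup>2)"
        using t by simp
      have "norm (2 *\<^sub>R B v w) \<le> norm (2 *\<^sub>R B v w + t *\<^sub>R B w w) + norm (t *\<^sub>R B w w)"
        by (metis add_diff_cancel_right' norm_triangle_ineq4)
      also have "norm (t *\<^sub>R B w w) \<le> t * (M * (norm w)\<^sup>2)"
        using M[of w w] t by (simp add: power2_eq_square mult_ac)
      finally show ?thesis using 1 by (simp add: algebra_simps)
    qed
    have l: "((\<lambda>t. t * ((K + M) * (norm w)\<^sup>2)) \<longlongrightarrow> 0 * ((K + M) * (norm w)\<^sup>2)) (at_right 0)"
      by (intro tendsto_intros)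
    have "((\<lambda>t. t * norm w) \<longlongrightarrow> 0 * norm w) (at_right (0::real))" by (intro tendsto_intros)
    then have "eventually (\<lambda>t. t * norm w < d) (at_right 0)"
      using d by (intro order_tendstoD) auto
    moreover have "eventually (\<lambda>t::real. 0 < t) (at_right 0)" by (rule eventually_at_right_less)
    ultimately have "eventually (\<lambda>t. 2 * norm (B v w) \<le> t * ((K + M) * (norm w)\<^sup>2)) (at_right 0)"
      by eventually_elim (rule lin)
    from tendsto_lowerbound[OF l this] have "2 * norm (B v w) \<le> 0" by simp
    then show ?thesis by simp
  qed
  then show ?thesis by (simp add: radical_def)
qed

text \<open>
  The radical consists of the points at which \<open>x \<mapsto> B x x\<close> has a quadratically small increment.
  This notion is bi-Lipschitz invariant; openness of \<open>\<Phi>\<close> is needed to reach all increments at the image.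
\<close>

lemma dim_radical_mono:
  fixes B C :: "'a::euclidean_space \<Rightarrow> 'a \<Rightarrow> 'b::euclidean_space"
  assumes B: "bounded_bilinear B" "\<And>x y. B x y = B y x"
    and C: "bounded_bilinear C" "\<And>x y. C x y = C y x"
    and \<Phi>: "bilip_on L (cball 0 1) \<Phi>" and BC: "\<And>x. x \<in> cball 0 1 \<Longrightarrow> B (\<Phi> x) (\<Phi> x) = C x x"
  shows "dim (radical C) \<le> dim (radical B)"
proof (rule invariance_of_dimension_subspaces[of _ "radical C \<inter> ball 0 1" _ \<Phi>])
  interpret C: bounded_bilinear C by (rule C(1))
  have L: "L > 0" using \<Phi> by (simp add: bilip_on_def)
  have inj: "inj_on \<Phi> (ball 0 1)"
    by (rule inj_on_subset[OF bilip_on_inj[OF \<Phi>]]) auto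
  have cont: "continuous_on (ball 0 1) \<Phi>"
    by (rule continuous_on_subset[OF bilip_on_continuous[OF \<Phi>]]) auto
  have op: "open (\<Phi> ` ball 0 1)" by (rule invariance_of_domain[OF cont open_ball inj])
  show "\<Phi> \<in> radical C \<inter> ball 0 1 \<rightarrow> radical B"
  proof
    fix x assume x: "x \<in> radical C \<inter> ball 0 1"
    then have "\<Phi> x \<in> \<Phi> ` ball 0 1" by blast
    with op obtain d where d: "d > 0" "ball (\<Phi> x) d \<subseteq> \<Phi> ` ball 0 1"
      using open_contains_ball by blast
    obtain M where M: "\<And>a b. norm (C a b) \<le> norm a * norm b * M" and "0 < M" using C.pos_bounded by blast
    show "\<Phi> x \<in> radical B"
    proof (rule radical_if_quadratic_increment[OF B d(1)])
      fix w :: 'a assume "norm w < d"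
      then have "\<Phi> x + w \<in> ball (\<Phi> x) d" by (simp add: dist_norm)
      with d(2) obtain y where y: "y \<in> ball 0 1" "\<Phi> y = \<Phi> x + w" by (metis imageE subsetD)
      have xc: "x \<in> cball 0 1" and yc: "y \<in> cball 0 1" using x y by auto
      have x0: "C x z = 0" "C z x = 0" for z using x C(2)[of z x] by (auto simp: radical_def)
      have "B (\<Phi> x + w) (\<Phi> x + w) - B (\<Phi> x) (\<Phi> x) = C y y - C x x"
        using BC[OF xc] BC[OF yc] y(2) by simp
      \<comment> \<open>Since \<open>x\<close> lies in the radical of \<open>C\<close>, the mixed
        terms vanish and the increment is exactly quadratic in \<open>y - x\<close>.\<close>
      also have "\<dots> = C (y - x) (y - x)" by (simp add: C.diff_left C.diff_right x0)
      finally have "norm (B (\<Phi> x + w) (\<Phi> x + w) - B (\<Phi> x) (\<Phi> x)) \<le> M * (norm (y - x))\<^sup>2"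
        using M[of "y - x" "y - x"] by (simp add: power2_eq_square mult_ac)
      \<comment> \<open>The lower bi-Lipschitz bound of \<Phi> controls the displacement of the
        preimage by that of the image.\<close>
      also have "norm (y - x) \<le> L * norm w"
        using bilip_onD(1)[OF \<Phi> yc xc] y(2) by simp
      then have "M * (norm (y - x))\<^sup>2 \<le> M * (L * norm w)\<^sup>2"
        using \<open>0 < M\<close> by (intro mult_left_mono power_mono) auto
      finally show "norm (B (\<Phi> x + w) (\<Phi> x + w) - B (\<Phi> x) (\<Phi> x)) \<le> (M * L\<^sup>2) * (norm w)\<^sup>2"
        by (simp add: power_mult_distrib)
    qed
  qed
  show "openin (top_of_set (radical C)) (radical C \<inter> ball 0 1)" by (simp add: openin_open_Int)
  show "subspace (radical C)" "subspace (radical B)"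
    using subspace_radical B(1) C(1) by blast+
  show "continuous_on (radical C \<inter> ball 0 1) \<Phi>" "inj_on \<Phi> (radical C \<inter> ball 0 1)"
    using cont inj by (auto intro: continuous_on_subset inj_on_subset)
  show "radical C \<inter> ball 0 1 \<noteq> {}"
    using subspace_0[OF subspace_radical[OF C(1)]] by auto
qed

section \<open>Representatives and symmetry of bi-Lipschitz equivalence\<close>

lemma bilipschitz_equivalentE:
  fixes f g :: "'a::real_normed_vector \<Rightarrow> 'b"
  assumes "bilipschitz_equivalent f g"
  obtains L r \<phi> where "bilip_on L (ball 0 r) \<phi>" "\<phi> 0 = 0" "r > 0"
    "\<And>x. x \<in> ball 0 r \<Longrightarrow> f (\<phi> x) = g x"
proof -
  obtain \<phi> U V \<psi> L where 1: "\<phi> 0 = 0" "open U" "0 \<in> U" "L > 0"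
    and bl: "\<And>x y. x \<in> U \<Longrightarrow> y \<in> U \<Longrightarrow>
           1 / L * norm (x - y) \<le> norm (\<phi> x - \<phi> y) \<and> norm (\<phi> x - \<phi> y) \<le> L * norm (x - y)"
    and ev: "\<forall>\<^sub>F x in nhds 0. f (\<phi> x) = g x"
    using assms unfolding bilipschitz_equivalent_def bilipschitz_homeo_germ_def by blast
  obtain W where W: "open W" "0 \<in> W" "\<And>x. x \<in> W \<Longrightarrow> f (\<phi> x) = g x"
    using ev unfolding eventually_nhds by blast
  have "open (U \<inter> W)" "0 \<in> U \<inter> W" using 1 W by auto
  then obtain r where r: "r > 0" "ball 0 r \<subseteq> U \<inter> W" using open_contains_ball by blast
  have "bilip_on L (ball 0 r) \<phi>"
    unfolding bilip_on_def using 1 bl r by (auto simp: field_simps subset_iff)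
  then show thesis using that 1 r W by blast
qed

text \<open>The inverse homeomorphism \<psi> satisfies the same bounds with the same
  \<open>L\<close>: inverting exchanges the lower and the upper estimate.\<close>

lemma bilipschitz_equivalent_sym:
  fixes f g :: "'a::real_normed_vector \<Rightarrow> 'b"
  assumes "bilipschitz_equivalent f g"
  shows "bilipschitz_equivalent g f"
proof -
  obtain \<phi> U V \<psi> L where 1: "\<phi> 0 = 0" "open U" "0 \<in> U" "open V" "0 \<in> V" "L > 0"
    and h: "homeomorphism U V \<phi> \<psi>"
    and bl: "\<And>x y. x \<in> U \<Longrightarrow> y \<in> U \<Longrightarrow>
           1 / L * norm (x - y) \<le> norm (\<phi> x - \<phi> y) \<and> norm (\<phi> x - \<phi> y) \<le> L * norm (x - y)"
    and ev: "\<forall>\<^sub>F x in nhds 0. f (\<phi> x) = g x"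
    using assms unfolding bilipschitz_equivalent_def bilipschitz_homeo_germ_def by blast
  have \<psi>0: "\<psi> 0 = 0" using h 1 unfolding homeomorphism_def by metis
  have bl': "1 / L * norm (x - y) \<le> norm (\<psi> x - \<psi> y) \<and> norm (\<psi> x - \<psi> y) \<le> L * norm (x - y)"
    if "x \<in> V" "y \<in> V" for x y
  proof -
    have "\<psi> x \<in> U" "\<psi> y \<in> U" "\<phi> (\<psi> x) = x" "\<phi> (\<psi> y) = y"
      using h that unfolding homeomorphism_def by auto
    then show ?thesis using bl[of "\<psi> x" "\<psi> y"] \<open>L > 0\<close> by (simp add: field_simps)
  qed
  have "continuous_on V \<psi>" using h by (simp add: homeomorphism_def)
  then have "isCont \<psi> 0" using 1 by (simp add: continuous_on_eq_continuous_at)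
  \<comment> \<open>As \<psi> tends to 0 at 0, the germ identity for \<open>f\<close> and \<phi> may
    be evaluated at \<open>\<psi> y\<close>.\<close>
  then have "filterlim \<psi> (nhds 0) (nhds 0)" using tendsto_at_iff_tendsto_nhds[of \<psi> 0] \<psi>0 by (simp add: isCont_def)
  then have "\<forall>\<^sub>F y in nhds 0. f (\<phi> (\<psi> y)) = g (\<psi> y)"
    by (rule eventually_compose_filterlim[OF ev])
  moreover have "\<forall>\<^sub>F y in nhds 0. y \<in> V" using 1 eventually_nhds by blast
  ultimately have "\<forall>\<^sub>F y in nhds 0. g (\<psi> y) = f y"
    by eventually_elim (use h in \<open>simp add: homeomorphism_def\<close>)
  moreover have "bilipschitz_homeo_germ \<psi>"
    unfolding bilipschitz_homeo_germ_def
    by (intro conjI exI[of _ V] exI[of _ U] exI[of _ \<phi>] exI[of _ L] ballI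
          homeomorphism_symD[OF h] 1 \<psi>0) (use bl' in blast)+
  ultimately show ?thesis
    unfolding bilipschitz_equivalent_def by blast
qed

text \<open>The inequality \<open>le\<close> is stated for arbitrary functions and forms, so one
  blow-up argument serves both directions.\<close>

lemma dim_radical_eq:
  fixes f g :: "'a::euclidean_space \<Rightarrow> 'b::euclidean_space"
  assumes f: "quad_approx f B" and g: "quad_approx g C" and eq: "bilipschitz_equivalent f g"
  shows "dim (radical B) = dim (radical C)"
proof -
  have le: "dim (radical C) \<le> dim (radical B)"
    if f: "quad_approx f B" and g: "quad_approx g C" and eq: "bilipschitz_equivalent f g"
    for f g :: "'a \<Rightarrow> 'b" and B C
  proof -
    obtain L r \<phi> where \<phi>: "bilip_on L (ball 0 r) \<phi>" "\<phi> 0 = 0" "r > 0"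
      "\<And>x. x \<in> ball 0 r \<Longrightarrow> f (\<phi> x) = g x"
      by (rule bilipschitz_equivalentE[OF eq]) (rule that)
    obtain \<Phi>
      where "bilip_on L (cball 0 1) \<Phi>" "\<And>x. x \<in> cball 0 1 \<Longrightarrow> B (\<Phi> x) (\<Phi> x) = C x x"
      by (rule bilip_blow_up[OF f g \<phi>]) (assumption, rule that)
    with f g show ?thesis by (intro dim_radical_mono) (auto simp: quad_approx_def)
  qed
  show ?thesis
    using le[OF f g eq] le[OF g f bilipschitz_equivalent_sym[OF eq]] by simp
qed

subsection \<open>Second-order expansion from partial derivatives\<close>

definition partially_differentiable_on :: "('k::real_normed_field ^ 'n::finite) set \<Rightarrow> ('k ^ 'n \<Rightarrow> 'k) \<Rightarrow> bool" where
  "partially_differentiable_on U f \<longleftrightarrow> (\<forall>x\<in>U. \<forall>i. (\<lambda>t. f (x + axis i t)) field_differentiable at 0)"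

definition c1_on :: "('k::real_normed_field ^ 'n::finite) set \<Rightarrow> ('k ^ 'n \<Rightarrow> 'k) \<Rightarrow> bool" where
  "c1_on U f \<longleftrightarrow> partially_differentiable_on U f \<and> (\<forall>i. continuous_on U (partial_deriv i f))"

lemma axis_add: "axis i (s + t) = axis i s + (axis i t :: 'k::real_normed_vector ^ 'n)"
  by (simp add: axis_def vec_eq_iff)

lemma axis_0 [simp]: "axis i 0 = 0"
  by (simp add: axis_def vec_eq_iff)

text \<open>\<open>partial_deriv\<close> differentiates at parameter 0; moving the base point along
  the coordinate line gives the derivative at every other parameter.\<close>

lemma partial_deriv_along_line:
  assumes "partially_differentiable_on U f" "x + axis i t \<in> U"
  shows "((\<lambda>s. f (x + axis i s)) has_field_derivative partial_deriv i f (x + axis i t)) (at t)"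
proof -
  have "((\<lambda>s. f ((x + axis i t) + axis i s)) has_field_derivative partial_deriv i f (x + axis i t)) (at 0)"
    unfolding partial_deriv_def
    using assms DERIV_deriv_iff_field_differentiable unfolding partially_differentiable_on_def by blast
  then have "((\<lambda>s. f (x + axis i (s + t))) has_field_derivative partial_deriv i f (x + axis i t)) (at 0)"
    by (simp add: axis_add add_ac)
  then show ?thesis
    using DERIV_shift[of "\<lambda>s. f (x + axis i s)" "partial_deriv i f (x + axis i t)" 0 t] by simp
qed

lemma norm_le_componentwise_vec:
  fixes a b :: "'k::real_normed_vector ^ 'n::finite"
  assumes "\<And>i. norm (a $ i) \<le> norm (b $ i)"
  shows "norm a \<le> norm b"
  unfolding norm_vec_def by (intro L2_set_mono assms) auto

lemma bounded_linear_row: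
  "bounded_linear (\<lambda>h::'k::real_normed_field ^ 'n::finite. \<Sum>i\<in>UNIV. h $ i * a i)"
  by (intro bounded_linear_sum bounded_linear_mult_const bounded_linear_vec_nth)

text \<open>Pass from \<open>x\<close> to \<open>y\<close> one coordinate at a time and apply the
  mean value inequality to each change. It is applied on a ball of \<open>'k\<close>, an interval or
  a disc, which covers both fields.\<close>

lemma c1_on_has_derivative:
  fixes f :: "'k::real_normed_field ^ 'n::finite \<Rightarrow> 'k"
  assumes c1: "c1_on U f" and U: "open U" and x: "x \<in> U"
  shows "(f has_derivative (\<lambda>h. \<Sum>i\<in>UNIV. h $ i * partial_deriv i f x)) (at x)"
  unfolding has_derivative_at_alt
proof (intro conjI allI impI bounded_linear_row)
  fix e :: real assume e: "e > 0"
  have f: "partially_differentiable_on U f" using c1 by (simp add: c1_on_def)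
  \<comment> \<open>The errors of the \<open>CARD('n)\<close> coordinate changes add up.\<close>
  define e' where "e' = e / real CARD('n)"
  have e': "e' > 0" using e by (simp add: e'_def)
  have "\<forall>\<^sub>F y in nhds x. \<forall>i. dist (partial_deriv i f y) (partial_deriv i f x) < e'"
  proof (rule eventually_all_finite)
    fix i
    have "isCont (partial_deriv i f) x"
      using c1 U x by (simp add: c1_on_def continuous_on_eq_continuous_at)
    then have "(partial_deriv i f \<longlongrightarrow> partial_deriv i f x) (nhds x)"
      using tendsto_at_iff_tendsto_nhds[of "partial_deriv i f" x] by (simp add: isCont_def)
    then show "\<forall>\<^sub>F y in nhds x. dist (partial_deriv i f y) (partial_deriv i f x) < e'"
      using e' by (rule tendstoD)
  qed
  moreover have "\<forall>\<^sub>F y in nhds x. y \<in> U" using U x eventually_nhds by blast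
  ultimately have "\<forall>\<^sub>F y in nhds x. y \<in> U \<and> (\<forall>i. dist (partial_deriv i f y) (partial_deriv i f x) < e')"
    by eventually_elim blast
  then obtain d where d: "d > 0"
    "\<And>y. dist y x < d \<Longrightarrow> y \<in> U \<and> (\<forall>i. dist (partial_deriv i f y) (partial_deriv i f x) < e')"
    unfolding eventually_nhds_metric by meson
  show "\<exists>d>0. \<forall>y. norm (y - x) < d \<longrightarrow>
      norm (f y - f x - (\<Sum>i\<in>UNIV. (y - x) $ i * partial_deriv i f x)) \<le> e * norm (y - x)"
  proof (intro exI[of _ d] conjI allI impI d(1))
    fix y assume y: "norm (y - x) < d"
    define h where "h = y - x"
    \<comment> \<open>As \<open>S\<close> grows from the empty set to \<open>UNIV\<close>,
      \<open>x + p S\<close> moves from \<open>x\<close> to \<open>y\<close>, one coordinate per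
      induction step.\<close>
    define p where "p S = (\<chi> i. if i \<in> S then h $ i else 0)" for S
    have "norm (f (x + p S) - f x - (\<Sum>i\<in>S. h $ i * partial_deriv i f x)) \<le> real (card S) * (e' * norm h)"
      if "finite S" for S
      using that
    proof (induction S rule: finite_induct)
      case empty
      have "p {} = 0" by (simp add: p_def vec_eq_iff)
      then show ?case by simp
    next
      case (insert j S)
      have ins: "p (insert j S) = p S + axis j (h $ j)"
        using insert.hyps by (auto simp: p_def vec_eq_iff axis_def)
      have near: "dist (x + p S + axis j t) x < d" if "norm t \<le> norm (h $ j)" for t :: 'k
      proof -
        have "norm (p S + axis j t) \<le> norm h"
          by (rule norm_le_componentwise_vec) (use that insert.hyps in \<open>auto simp: p_def axis_def\<close>)
        then show ?thesis using y by (simp add: dist_norm h_def add.assoc)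
      qed
      \<comment> \<open>With the linear part subtracted, the derivative of \<open>F\<close> is the
        variation of the partial derivative near \<open>x\<close>, which is below
        \<open>e'\<close>.\<close>
      define F where "F t = f (x + p S + axis j t) - t * partial_deriv j f x" for t :: 'k
      have "norm (F (h $ j) - F 0) \<le> e' * norm (h $ j - 0)"
      proof (rule field_differentiable_bound[of "cball 0 (norm (h $ j))"])
        fix t :: 'k assume "t \<in> cball 0 (norm (h $ j))"
        then have n: "dist (x + p S + axis j t) x < d" using near by simp
        have "(F has_field_derivative partial_deriv j f (x + p S + axis j t) - partial_deriv j f x) (at t)"
          unfolding F_def
          using d(2)[OF n] by (auto intro!: derivative_eq_intros partial_deriv_along_line[OF f])
        then show "(F has_field_derivative partial_deriv j f (x + p S + axis j t) - partial_deriv j f x)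
            (at t within cball 0 (norm (h $ j)))"
          by (rule has_field_derivative_at_within)
        show "norm (partial_deriv j f (x + p S + axis j t) - partial_deriv j f x) \<le> e'"
          using d(2)[OF n] by (auto simp: dist_norm intro: less_imp_le)
      qed auto
      also have "F (h $ j) - F 0 = f (x + p (insert j S)) - f (x + p S) - h $ j * partial_deriv j f x"
        by (simp add: F_def ins add.assoc)
      also have "e' * norm (h $ j - 0) \<le> e' * norm h"
        using e' Finite_Cartesian_Product.norm_nth_le[of h j] by simp
      finally have 1: "norm (f (x + p (insert j S)) - f (x + p S) - h $ j * partial_deriv j f x) \<le> e' * norm h" .
      have "f (x + p (insert j S)) - f x - (\<Sum>i\<in>insert j S. h $ i * partial_deriv i f x)
        = (f (x + p (insert j S)) - f (x + p S) - h $ j * partial_deriv j f x)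
          + (f (x + p S) - f x - (\<Sum>i\<in>S. h $ i * partial_deriv i f x))"
        using insert.hyps by (simp add: algebra_simps)
      also have "norm \<dots> \<le> e' * norm h + real (card S) * (e' * norm h)"
        by (rule order_trans[OF norm_triangle_ineq add_mono[OF 1 insert.IH]])
      finally show ?case using insert.hyps by (simp add: algebra_simps)
    qed
    from this[of UNIV] have "norm (f (x + p UNIV) - f x - (\<Sum>i\<in>UNIV. h $ i * partial_deriv i f x)) \<le> e * norm h"
      by (simp add: e'_def)
    moreover have "x + p UNIV = y" by (simp add: p_def h_def vec_eq_iff)
    ultimately show "norm (f y - f x - (\<Sum>i\<in>UNIV. (y - x) $ i * partial_deriv i f x)) \<le> e * norm (y - x)"
      by (simp add: h_def)
  qed
qed

section \<open>The Hessian as a bilinear form\<close>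

text \<open>The inner sum is the candidate for the derivative of \<open>partial_deriv j f\<close> at
  0 in direction \<open>x\<close>. Symmetry is not built in; it is proved in
  \<open>quad_approx_hessian_form\<close>.\<close>

definition hessian_form :: "('k::real_normed_field ^ 'n::finite \<Rightarrow> 'k) \<Rightarrow> 'k ^ 'n \<Rightarrow> 'k ^ 'n \<Rightarrow> 'k" where
  "hessian_form f x w = (\<Sum>j\<in>UNIV. w $ j * (\<Sum>i\<in>UNIV. x $ i * hessian f $ i $ j))"

lemma bounded_bilinear_hessian_form:
  fixes f :: "'k::{real_normed_field,euclidean_space} ^ 'n::finite \<Rightarrow> 'k"
  shows "bounded_bilinear (hessian_form f)"
  unfolding bilinear_conv_bounded_bilinear[symmetric] bilinear_def hessian_form_def
  by (intro conjI allI linearI)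
     (simp_all add: algebra_simps sum.distrib sum_distrib_left scaleR_sum_right)

text \<open>By definition the form pairs \<open>w\<close> with the transposed Hessian applied to
  \<open>v\<close>; symmetry removes the transpose.\<close>

lemma hessian_form_mult_vec:
  assumes "\<And>x y. hessian_form f x y = hessian_form f y x"
  shows "hessian_form f v w = (\<Sum>i\<in>UNIV. w $ i * (hessian f *v v) $ i)"
  unfolding assms[of v w]
  by (simp add: hessian_form_def matrix_vector_mult_def sum_distrib_left mult_ac)
     (rule sum.swap)

text \<open>Pairing with \<open>axis i 1\<close> reads off the coordinates of
  \<open>hessian f *v v\<close>.\<close>

lemma radical_hessian_form:
  fixes f :: "'k::real_normed_field ^ 'n::finite \<Rightarrow> 'k"
  assumes "\<And>x y. hessian_form f x y = hessian_form f y x"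
  shows "radical (hessian_form f) = {v. hessian f *v v = 0}"
proof -
  have 1: "(hessian f *v v) $ i = hessian_form f v (axis i 1)" for v i
    unfolding hessian_form_mult_vec[OF assms] by (simp add: axis_def if_distrib[of "\<lambda>x. x * _"] cong: if_cong)
  have 2: "hessian_form f v w = 0" if "hessian f *v v = 0" for v w
    unfolding hessian_form_mult_vec[OF assms] that by simp
  show ?thesis
    unfolding radical_def by (intro Collect_cong) (metis 1 2 vec_eq_iff zero_index)
qed

text \<open>Both the symmetry of the Hessian and the Taylor condition follow from
  \<open>inc\<close>, an expansion at every base point \<open>x\<close> near 0 whose error is small
  relative to (|x| + |w|) |w|.\<close>

lemma quad_approx_hessian_form:
  fixes f :: "'k::{real_normed_field,euclidean_space} ^ 'n::finite \<Rightarrow> 'k"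
  assumes U: "open U" "0 \<in> U" and f: "c1_on U f" and df: "\<And>i. c1_on U (partial_deriv i f)"
    and f0: "f 0 = 0" "critical_at_0 f"
  shows "quad_approx f (hessian_form f)"
proof -
  define B where "B = hessian_form f"
  define D where "D y w = (\<Sum>j\<in>UNIV. w $ j * partial_deriv j f y)" for y w
  interpret B: bounded_bilinear B
    unfolding B_def by (rule bounded_bilinear_hessian_form)
  have Dlin: "bounded_linear (D y)" for y unfolding D_def by (rule bounded_linear_row)
  \<comment> \<open>The gradient vanishes at 0, so near 0 the derivative \<open>D y\<close> agrees
    with its linearisation \<open>B y\<close> up to o(|y|).\<close>
  have DB: "\<exists>d>0. \<forall>y w. norm y < d \<longrightarrow> y \<in> U \<and> norm (D y w - B y w) \<le> e * (norm y * norm w)"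
    if e: "e > 0" for e
  proof -
    define e' where "e' = e / real CARD('n)"
    have e': "e' > 0" using e by (simp add: e'_def)
    define G where "G j y = (\<Sum>i\<in>UNIV. y $ i * hessian f $ i $ j)" for j and y :: "'k ^ 'n"
    have "\<forall>\<^sub>F y in nhds 0. \<forall>j. norm (partial_deriv j f y - G j y) \<le> e' * norm y"
    proof (rule eventually_all_finite)
      fix j
      have "(partial_deriv j f has_derivative G j) (at 0)"
        using c1_on_has_derivative[OF df U, of j] unfolding G_def hessian_def by simp
      then obtain d where "d > 0" "\<And>y. norm (y - 0) < d \<Longrightarrow>
         norm (partial_deriv j f y - partial_deriv j f 0 - G j (y - 0)) \<le> e' * norm (y - 0)"
        using e' unfolding has_derivative_at_alt by meson
      then show "\<forall>\<^sub>F y in nhds 0. norm (partial_deriv j f y - G j y) \<le> e' * norm y"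
        using f0 unfolding eventually_nhds_metric critical_at_0_def by auto
    qed
    moreover have "\<forall>\<^sub>F y in nhds 0. y \<in> U" using U eventually_nhds by blast
    ultimately have "\<forall>\<^sub>F y in nhds 0. y \<in> U \<and> (\<forall>j. norm (partial_deriv j f y - G j y) \<le> e' * norm y)"
      by eventually_elim blast
    then obtain d where d: "d > 0"
      "\<And>y. norm y < d \<Longrightarrow> y \<in> U \<and> (\<forall>j. norm (partial_deriv j f y - G j y) \<le> e' * norm y)"
      unfolding eventually_nhds_metric dist_norm diff_zero by meson
    have "norm (D y w - B y w) \<le> e * (norm y * norm w)" if y: "norm y < d" for y w
    proof -
      have "D y w - B y w = (\<Sum>j\<in>UNIV. w $ j * (partial_deriv j f y - G j y))"
        by (simp add: D_def B_def hessian_form_def G_def sum_subtractf right_diff_distrib)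
      also have "norm \<dots> \<le> (\<Sum>j\<in>(UNIV::'n set). norm w * (e' * norm y))"
        using d(2)[OF y] Finite_Cartesian_Product.norm_nth_le[of w]
        by (intro sum_norm_le) (auto simp: norm_mult intro!: mult_mono)
      also have "\<dots> = e * (norm y * norm w)" by (simp add: e'_def)
      finally show ?thesis .
    qed
    with d show ?thesis by blast
  qed
  have inc: "\<exists>d>0. \<forall>x w. norm x < d \<longrightarrow> norm w < d \<longrightarrow>
      norm (f (x + w) - f x - B x w - B w w /\<^sub>R 2) \<le> e * (norm x + norm w) * norm w"
    if e: "e > 0" for e
  proof -
    obtain d where d: "d > 0"
      "\<And>y w. norm y < d \<Longrightarrow> y \<in> U \<and> norm (D y w - B y w) \<le> e * (norm y * norm w)"
      using DB[OF e] by blast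
    have "norm (f (x + w) - f x - B x w - B w w /\<^sub>R 2) \<le> e * (norm x + norm w) * norm w"
      if xw: "norm x < d / 2" "norm w < d / 2" for x w
    proof -
      \<comment> \<open>As B(x,w) + t B(w,w) = B(x + t w, w), the derivative of \<open>F\<close> at
        \<open>t\<close> is \<open>D - B\<close> at x + t w, applied to \<open>w\<close>. The bounds
        \<open>d / 2\<close> keep the segment inside the ball of radius \<open>d\<close>.\<close>
      define F where "F t = f (x + t *\<^sub>R w) - t *\<^sub>R B x w - (t\<^sup>2 / 2) *\<^sub>R B w w" for t :: real
      have "norm (F 1 - F 0) \<le> e * (norm x + norm w) * norm w * norm (1 - 0 :: real)"
      proof (rule differentiable_bound[of "{0..1}"])
        fix t :: real assume t: "t \<in> {0..1}"
        let ?y = "x + t *\<^sub>R w"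
        have "norm (t *\<^sub>R w) \<le> norm w" using t by (simp add: mult_left_le_one_le)
        then have ny: "norm ?y \<le> norm x + norm w"
          using norm_triangle_ineq[of x "t *\<^sub>R w"] by linarith
        then have "norm ?y < d" using xw by linarith
        note y = d(2)[OF this, of w]
        have "((\<lambda>t. x + t *\<^sub>R w) has_derivative (\<lambda>s. s *\<^sub>R w)) (at t within {0..1})"
          by (auto intro!: derivative_eq_intros)
        moreover have "(f has_derivative D ?y) (at ?y)"
          using c1_on_has_derivative[OF f U(1), of ?y] y unfolding D_def[abs_def] by blast
        ultimately have "((\<lambda>t. f (x + t *\<^sub>R w)) has_derivative (\<lambda>s. D ?y (s *\<^sub>R w))) (at t within {0..1})"
          by (rule has_derivative_compose)
        moreover have "((\<lambda>t. t\<^sup>2 / 2) has_derivative (\<lambda>s. s * t)) (at t within {0..1})"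
          by (auto intro!: derivative_eq_intros)
        ultimately show "(F has_derivative (\<lambda>s. D ?y (s *\<^sub>R w) - s *\<^sub>R B x w - (s * t) *\<^sub>R B w w)) (at t within {0..1})"
          unfolding F_def by (auto intro!: derivative_intros)
        have "D ?y (s *\<^sub>R w) - s *\<^sub>R B x w - (s * t) *\<^sub>R B w w = s *\<^sub>R (D ?y w - B ?y w)" for s
          using linear_cmul[OF bounded_linear.linear[OF Dlin], of ?y s w]
          by (simp add: B.add_left B.scaleR_left algebra_simps)
        moreover have "norm (s *\<^sub>R (D ?y w - B ?y w)) \<le> (e * (norm x + norm w) * norm w) * norm s" for s
        proof -
          have "e * (norm ?y * norm w) \<le> e * (norm x + norm w) * norm w"
            using ny e by (simp add: mult_right_mono mult.assoc)
          then have "norm (D ?y w - B ?y w) \<le> e * (norm x + norm w) * norm w" using y by linarith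
          then show ?thesis by (simp add: mult.commute[of _ "\<bar>s\<bar>"] mult_left_mono)
        qed
        ultimately show "onorm (\<lambda>s. D ?y (s *\<^sub>R w) - s *\<^sub>R B x w - (s * t) *\<^sub>R B w w)
            \<le> e * (norm x + norm w) * norm w"
          by (intro onorm_le) simp
      qed auto
      then show ?thesis by (simp add: F_def algebra_simps)
    qed
    then show ?thesis using d(1) by (intro exI[of _ "d/2"]) auto
  qed
  \<comment> \<open>Expand \<open>f (t x + t w)\<close> around \<open>t x\<close> and around \<open>0\<close>, and compare the terms of order \<open>t\<^sup>2\<close>.\<close>
  have sym: "B x w = B w x" for x w
  proof -
    have bound: "norm (B w x - B x w) \<le> e" if e: "e > 0" for e
    proof -
      define M where "M = norm x + norm w + 1"
      have M: "M > 0" "norm x \<le> M" "norm w \<le> M" "norm (x + w) \<le> M" "norm x + norm w \<le> M"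
        unfolding M_def using norm_triangle_ineq[of x w] norm_ge_zero[of x] norm_ge_zero[of w]
        by linarith+
      \<comment> \<open>Each of the three remainders compared below is then at most t^2 e/6, and
        together they give t^2 e/2 = u e.\<close>
      define e' where "e' = e / (6 * M\<^sup>2)"
      have e': "e' > 0" using e M by (simp add: e'_def)
      obtain d where d: "d > 0" "\<And>x w. norm x < d \<Longrightarrow> norm w < d \<Longrightarrow>
          norm (f (x + w) - f x - B x w - B w w /\<^sub>R 2) \<le> e' * (norm x + norm w) * norm w"
        using inc[OF e'] by blast
      define R where "R x w = f (x + w) - f x - B x w - B w w /\<^sub>R 2" for x w
      define t where "t = d / (2 * M)"
      have t: "t > 0" "t * M < d" using d M by (auto simp: t_def)
      have Rb: "norm (R (t *\<^sub>R a) (t *\<^sub>R b)) \<le> t\<^sup>2 * (e / 6)"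
        if "norm a + norm b \<le> M" for a b
      proof -
        have ab: "norm a \<le> M" "norm b \<le> M" using that norm_ge_zero[of a] norm_ge_zero[of b] by linarith+
        have "norm (t *\<^sub>R a) < d" "norm (t *\<^sub>R b) < d"
          using ab t by (simp_all, meson le_less_trans mult_left_mono less_imp_le)+
        from d(2)[OF this] have "norm (R (t *\<^sub>R a) (t *\<^sub>R b)) \<le> t\<^sup>2 * (e' * ((norm a + norm b) * norm b))"
          using t by (simp add: R_def power2_eq_square algebra_simps)
        also have "\<dots> \<le> t\<^sup>2 * (e' * (M * M))"
          using e' ab that M by (intro mult_left_mono mult_mono) auto
        also have "e' * (M * M) = e / 6" using M by (simp add: e'_def power2_eq_square)
        finally show ?thesis .
      qed
      define u where "u = t\<^sup>2 / 2"
      have 1: "B (t *\<^sub>R x) (t *\<^sub>R w) = u *\<^sub>R B x w + u *\<^sub>R B x w"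
        by (simp add: u_def B.scaleR_left B.scaleR_right power2_eq_square flip: scaleR_add_left)
      have 2: "B (t *\<^sub>R y) (t *\<^sub>R y) /\<^sub>R 2 = u *\<^sub>R B y y" for y
        by (simp add: u_def B.scaleR_left B.scaleR_right power2_eq_square)
      \<comment> \<open>The values of \<open>f\<close> and the terms in \<open>B x x\<close> and
        \<open>B w w\<close> cancel; of the mixed terms the antisymmetric part is left.\<close>
      have "u *\<^sub>R (B w x - B x w)
          = R (t *\<^sub>R x) (t *\<^sub>R w) - R (t *\<^sub>R 0) (t *\<^sub>R (x + w)) + R (t *\<^sub>R 0) (t *\<^sub>R x)"
        unfolding R_def 1 2
        by (simp add: f0 B.zero_left B.add_left B.add_right scaleR_add_right scaleR_diff_right)
      then have "norm (u *\<^sub>R (B w x - B x w)) \<le> norm (R (t *\<^sub>R x) (t *\<^sub>R w))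
          + norm (R (t *\<^sub>R 0) (t *\<^sub>R (x + w))) + norm (R (t *\<^sub>R 0) (t *\<^sub>R x))"
        by (simp only:) (intro order_trans[OF norm_triangle_ineq] add_right_mono norm_triangle_ineq4)
      also have "\<dots> \<le> t\<^sup>2 * (e / 6) + t\<^sup>2 * (e / 6) + t\<^sup>2 * (e / 6)"
        using M by (intro add_mono Rb) simp_all
      finally have "u * norm (B w x - B x w) \<le> u * e" by (simp add: u_def mult.commute)
      then show ?thesis using t by (simp add: u_def)
    qed
    have "norm (B w x - B x w) \<le> 0" by (rule field_le_epsilon) (simp add: bound)
    then show ?thesis by simp
  qed
  \<comment> \<open>This is \<open>inc\<close> at base point 0.\<close>
  have "\<exists>d>0. \<forall>x. norm x < d \<longrightarrow> norm (f x - B x x /\<^sub>R 2) \<le> e * (norm x)\<^sup>2" if e: "e > 0" for e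
  proof -
    obtain d where d: "d > 0" "\<And>x w. norm x < d \<Longrightarrow> norm w < d \<Longrightarrow>
        norm (f (x + w) - f x - B x w - B w w /\<^sub>R 2) \<le> e * (norm x + norm w) * norm w"
      using inc[OF e] by blast
    have "norm (f x - B x x /\<^sub>R 2) \<le> e * (norm x)\<^sup>2" if "norm x < d" for x
      using d(2)[of 0 x] that d(1) by (simp add: f0 B.zero_left power2_eq_square mult.assoc)
    with d(1) show ?thesis by blast
  qed
  with sym show ?thesis
    unfolding quad_approx_def B_def[symmetric] using B.bounded_bilinear_axioms by blast
qed

section \<open>Transfer of criticality and comparison of Hessian kernels\<close>

text \<open>Near 0, \<open>f\<close> is O(|x|^2) and \<phi> enlarges norms at most by the factor
  \<open>L\<close>, so \<open>g\<close> is O(|x|^2) too and its derivative at 0 vanishes.\<close>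

lemma critical_at_0_bilipschitz:
  fixes f g :: "'k::{real_normed_field,euclidean_space} ^ 'n::finite \<Rightarrow> 'k"
  assumes f: "quad_approx f B" and g: "c1_on U g" "open U" "0 \<in> U" "g 0 = 0"
    and eq: "bilipschitz_equivalent f g"
  shows "critical_at_0 g"
proof -
  interpret bounded_bilinear B using f by (simp add: quad_approx_def)
  obtain M where M: "0 < M" "\<And>a b. norm (B a b) \<le> norm a * norm b * M" using pos_bounded by blast
  obtain d where d: "d > 0" "\<And>x. norm x < d \<Longrightarrow> norm (f x - B x x /\<^sub>R 2) \<le> 1 * (norm x)\<^sup>2"
    using f unfolding quad_approx_def by (meson zero_less_one)
  obtain L r \<phi> where \<phi>: "bilip_on L (ball 0 r) \<phi>" "\<phi> 0 = 0" "r > 0"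
    "\<And>x. x \<in> ball 0 r \<Longrightarrow> f (\<phi> x) = g x"
    by (rule bilipschitz_equivalentE[OF eq]) (rule that)
  have L: "L > 0" using \<phi> by (simp add: bilip_on_def)
  \<comment> \<open>\<open>M\<close> bounds the form (its factor 1/2 is dropped), 1 is the Taylor
    error, and the square of \<open>L\<close> comes from |\<phi> x| \<le> L |x|.\<close>
  define K where "K = (M + 1) * L\<^sup>2"
  have K: "K > 0" using M L by (simp add: K_def)
  have quad: "norm (g x) \<le> K * (norm x)\<^sup>2" if x: "norm x < min r (d / L)" for x
  proof -
    have \<phi>x: "norm (\<phi> x) \<le> L * norm x"
      using bilip_onD(2)[OF \<phi>(1), of x 0] x \<phi> by simp
    also have "\<dots> < d" using x L by (simp add: field_simps)
    finally have "norm (f (\<phi> x) - B (\<phi> x) (\<phi> x) /\<^sub>R 2) \<le> (norm (\<phi> x))\<^sup>2" using d(2) by simp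
    moreover have "norm (B (\<phi> x) (\<phi> x) /\<^sub>R 2) \<le> M * (norm (\<phi> x))\<^sup>2"
    proof -
      have "norm (B (\<phi> x) (\<phi> x) /\<^sub>R 2) \<le> norm (B (\<phi> x) (\<phi> x))" by simp
      also have "\<dots> \<le> M * (norm (\<phi> x))\<^sup>2"
        using M(2)[of "\<phi> x" "\<phi> x"] by (simp add: power2_eq_square mult_ac)
      finally show ?thesis .
    qed
    ultimately have "norm (f (\<phi> x)) \<le> (M + 1) * (norm (\<phi> x))\<^sup>2"
      using norm_triangle_sub[of "f (\<phi> x)" "B (\<phi> x) (\<phi> x) /\<^sub>R 2"] by (simp add: algebra_simps)
    also have "\<dots> \<le> (M + 1) * (L * norm x)\<^sup>2"
      using M \<phi>x by (intro mult_left_mono power_mono) auto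
    finally show ?thesis using \<phi>(4)[of x] x by (simp add: K_def power_mult_distrib)
  qed
  have "(g has_derivative (\<lambda>_. 0)) (at 0)"
    unfolding has_derivative_at_alt
  proof (intro conjI allI impI bounded_linear_zero)
    fix e :: real assume e: "e > 0"
    show "\<exists>\<delta>>0. \<forall>y. norm (y - 0) < \<delta> \<longrightarrow> norm (g y - g 0 - 0) \<le> e * norm (y - 0)"
    proof (intro exI[of _ "min (min r (d / L)) (e / K)"] conjI allI impI)
      fix y :: "'k ^ 'n" assume y: "norm (y - 0) < min (min r (d / L)) (e / K)"
      then have "K * norm y \<le> e" using K by (simp add: field_simps)
      then have "K * norm y * norm y \<le> e * norm y" by (intro mult_right_mono) auto
      then show "norm (g y - g 0 - 0) \<le> e * norm (y - 0)"
        using quad[of y] y g by (simp add: power2_eq_square mult.assoc)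
    qed (use \<phi> d L e K in auto)
  qed
  from has_derivative_unique[OF this c1_on_has_derivative[OF g(1-3)]]
  have eq0: "(\<Sum>i\<in>UNIV. h $ i * partial_deriv i g 0) = 0" for h
    by metis
  show ?thesis
    unfolding critical_at_0_def
  proof
    fix i show "partial_deriv i g 0 = 0"
      using eq0[of "axis i 1"] by (simp add: axis_def if_distrib[of "\<lambda>x. x * _"] cong: if_cong)
  qed
qed

text \<open>Here \<open>dim\<close> is the real dimension, also for complex germs, because the
  topological argument sees only the real structure.\<close>

lemma dim_hessian_kernel_eq:
  fixes f g :: "'k::{real_normed_field,euclidean_space} ^ 'n::finite \<Rightarrow> 'k"
  assumes f: "open U" "0 \<in> U" "c1_on U f" "\<And>i. c1_on U (partial_deriv i f)" "f 0 = 0" "critical_at_0 f"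
    and g: "open V" "0 \<in> V" "c1_on V g" "\<And>i. c1_on V (partial_deriv i g)" "g 0 = 0"
    and eq: "bilipschitz_equivalent f g"
  shows "dim {v. hessian f *v v = 0} = dim {v. hessian g *v v = 0}"
proof -
  have qf: "quad_approx f (hessian_form f)" by (rule quad_approx_hessian_form[OF f])
  have "critical_at_0 g" by (rule critical_at_0_bilipschitz[OF qf g(3,1,2,5) eq])
  then have qg: "quad_approx g (hessian_form g)" by (rule quad_approx_hessian_form[OF g])
  show ?thesis
    using dim_radical_eq[OF qf qg eq] qf qg radical_hessian_form[of f] radical_hessian_form[of g]
    unfolding quad_approx_def by simp
qed

text \<open>Differentiating \<open>partial_derivs is f\<close> once more lengthens the list by one,
  so every iterated derivative is C^1 on the same neighbourhood; lists of length 0 and 1 give the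
  claim.\<close>

lemma smooth_germ_c1_on:
  fixes f :: "real ^ 'n::finite \<Rightarrow> real"
  assumes "smooth_germ f"
  obtains U where "open U" "0 \<in> U" "c1_on U f" "\<And>i. c1_on U (partial_deriv i f)"
proof -
  obtain U where U: "open U" "0 \<in> U" and c: "\<And>is. continuous_on U (partial_derivs is f)"
    and d: "\<And>is x i. x \<in> U \<Longrightarrow> (\<lambda>t. partial_derivs is f (x + axis i t)) field_differentiable at 0"
    using assms unfolding smooth_germ_def by blast
  have "c1_on U (partial_derivs is f)" for "is"
    unfolding c1_on_def partially_differentiable_on_def using c[of "_ # is"] d[of _ "is"] by (simp add: partial_derivs_def)
  from this[of "[]"] this[of "[_]"] show thesis
    using that U by (simp add: partial_derivs_def)
qed

subsection \<open>Holomorphic germs\<close>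

lemma norm_axis_eq: "norm (axis i t :: 'k::real_normed_vector ^ 'n::finite) = norm t"
proof -
  have "(norm (if j = i then t else 0))\<^sup>2 = (if j = i then (norm t)\<^sup>2 else 0)" for j by simp
  then show ?thesis by (simp add: norm_vec_def L2_set_def axis_def)
qed

lemma bounded_linear_axis: "bounded_linear (axis i :: 'k \<Rightarrow> 'k::real_normed_vector ^ 'n::finite)"
proof (rule bounded_linear_intro[where K = 1])
  show "axis i (r *\<^sub>R t) = r *\<^sub>R (axis i t :: 'k ^ 'n)" for r t
    by (simp add: axis_def vec_eq_iff)
qed (simp_all add: axis_add norm_axis_eq)

text \<open>Cauchy's inequality for the difference of \<open>f\<close> on two parallel coordinate
  discs bounds the difference of the partial derivatives at their centres. Uniform continuity of
  \<open>f\<close> on a compact ball makes it small.\<close>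

lemma continuous_on_partial_deriv:
  fixes f :: "complex ^ 'n::finite \<Rightarrow> complex"
  assumes U: "open U" and cont: "continuous_on U f" and diff: "partially_differentiable_on U f"
  shows "continuous_on U (partial_deriv i f)"
  unfolding continuous_on_eq_continuous_at[OF U]
proof
  fix x assume x: "x \<in> U"
  obtain R where R: "R > 0" "cball x R \<subseteq> U" using U x open_contains_cball by blast
  \<comment> \<open>Halving leaves room to move the base point by \<open>r\<close> and then one
    coordinate by \<open>r\<close>.\<close>
  define r where "r = R / 2"
  have r: "r > 0" "cball x (2 * r) \<subseteq> U" using R by (auto simp: r_def)
  have near: "y + axis i t \<in> cball x (2 * r)" if "y \<in> cball x r" "t \<in> cball 0 r" for y and t :: complex
    using that norm_triangle_ineq4[of "x - y" "axis i t"]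
    by (simp add: dist_norm norm_axis_eq algebra_simps)
  have "uniformly_continuous_on (cball x (2 * r)) f"
    by (intro compact_uniformly_continuous continuous_on_subset[OF cont r(2)]) auto
  note uc = this[unfolded uniformly_continuous_on_def]
  show "isCont (partial_deriv i f) x"
    unfolding continuous_at_eps_delta
  proof (intro allI impI)
    fix e :: real assume e: "e > 0"
    \<comment> \<open>Cauchy's inequality divides by \<open>r\<close>, leaving
      \<open>e / 2\<close>.\<close>
    then have "e * r / 2 > 0" using r by simp
    then obtain d where d: "d > 0" "\<And>y z. y \<in> cball x (2 * r) \<Longrightarrow> z \<in> cball x (2 * r) \<Longrightarrow> dist z y < d
        \<Longrightarrow> dist (f z) (f y) < e * r / 2"
      using uc by meson
    show "\<exists>d>0. \<forall>y. dist y x < d \<longrightarrow> dist (partial_deriv i f y) (partial_deriv i f x) < e"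
    proof (intro exI[of _ "min d r"] conjI allI impI)
      fix y assume "dist y x < min d r"
      then have y: "norm (y - x) < min d r" by (simp add: dist_norm)
      have yc: "y \<in> cball x r" and xc: "x \<in> cball x r"
        using y r by (auto simp: dist_norm norm_minus_commute)
      define F where "F t = f (y + axis i t) - f (x + axis i t)" for t
      have F': "(F has_field_derivative partial_deriv i f (y + axis i t) - partial_deriv i f (x + axis i t)) (at t)"
        if "t \<in> cball 0 r" for t
        unfolding F_def
        using near[OF yc that] near[OF xc that] r(2)
        by (intro DERIV_diff partial_deriv_along_line[OF diff]) auto
      then have Fd: "F field_differentiable at t" if "t \<in> cball 0 r" for t
        using that unfolding field_differentiable_def by blast
      have "cmod ((deriv ^^ 1) F 0) \<le> fact 1 * (e * r / 2) / r ^ 1"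
      proof (rule Cauchy_inequality[OF _ _ r(1)])
        show "F holomorphic_on ball 0 r"
          by (rule holomorphic_onI, rule field_differentiable_at_within, rule Fd) simp
        show "continuous_on (cball 0 r) F"
          by (intro continuous_at_imp_continuous_on ballI field_differentiable_imp_continuous_at Fd)
        fix t :: complex assume "cmod (0 - t) = r"
        then have t: "t \<in> cball 0 r" by simp
        show "cmod (F t) \<le> e * r / 2"
          using d(2)[OF near[OF xc t] near[OF yc t]] y by (simp add: F_def dist_norm)
      qed
      moreover have "deriv F 0 = partial_deriv i f y - partial_deriv i f x"
        using DERIV_imp_deriv[OF F'[of 0]] r by (simp)
      ultimately have "cmod (partial_deriv i f y - partial_deriv i f x) \<le> e / 2" using r by simp
      then show "dist (partial_deriv i f y) (partial_deriv i f x) < e" using e by (simp add: dist_norm)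
    qed (use d r in auto)
  qed
qed

text \<open>In the variable of direction \<open>j\<close>, the partial derivative in direction
  \<open>i\<close> is a uniform limit of holomorphic difference quotients, hence holomorphic by
  Weierstrass' theorem.\<close>

lemma partially_differentiable_on_partial_deriv:
  fixes f :: "complex ^ 'n::finite \<Rightarrow> complex"
  assumes U: "open U" and cont: "continuous_on U f" and diff: "partially_differentiable_on U f"
  shows "partially_differentiable_on U (partial_deriv i f)"
  unfolding partially_differentiable_on_def
proof (intro ballI allI)
  fix x j assume x: "x \<in> U"
  obtain R where R: "R > 0" "cball x R \<subseteq> U" using U x open_contains_cball by blast
  define r where "r = R / 2"
  have r: "r > 0" "cball x (2 * r) \<subseteq> U" using R by (auto simp: r_def)
  have near: "x + axis j s + axis i t \<in> cball x (2 * r)" if "s \<in> cball 0 r" "t \<in> cball 0 r" for s t :: complex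
    using that norm_triangle_ineq[of "axis j s" "axis i t"]
      dist_commute[of x "x + (axis j s + axis i t)"]
    by (simp add: dist_norm[of "x + _"] norm_axis_eq add.assoc)
  then have near0: "x + axis j s \<in> cball x (2 * r)" if "s \<in> cball 0 r" for s :: complex
    using that r by (simp add: dist_norm norm_axis_eq)
  have "uniformly_continuous_on (cball x (2 * r)) (partial_deriv i f)"
    by (intro compact_uniformly_continuous
          continuous_on_subset[OF continuous_on_partial_deriv[OF assms] r(2)]) auto
  note uc = this[unfolded uniformly_continuous_on_def]
  \<comment> \<open>The increments are nonzero, stay in the disc of radius \<open>r\<close> and tend
    to 0.\<close>
  define \<tau> where "\<tau> n = complex_of_real (r / real (Suc n))" for n
  have \<tau>: "\<tau> n \<noteq> 0" "\<tau> n \<in> cball 0 r" for n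
    using r by (simp_all add: \<tau>_def norm_divide field_simps del: of_nat_Suc)
  have "\<tau> \<longlonglongrightarrow> complex_of_real 0"
    unfolding \<tau>_def by (rule tendsto_of_real[OF LIMSEQ_Suc[OF lim_const_over_n]])
  then have \<tau>0: "\<tau> \<longlonglongrightarrow> 0" by simp
  define F where "F n s = (f (x + axis j s + axis i (\<tau> n)) - f (x + axis j s)) / \<tau> n" for n s
  define G where "G s = partial_deriv i f (x + axis j s)" for s
  have F': "F n field_differentiable (at s)" if s: "s \<in> cball 0 r" for n s
  proof -
    have "((\<lambda>s. f ((x + axis i (\<tau> n)) + axis j s)) has_field_derivative
            partial_deriv j f ((x + axis i (\<tau> n)) + axis j s)) (at s)"
      using near[OF s \<tau>(2), of n] r(2)
      by (intro partial_deriv_along_line[OF diff]) (auto simp: add_ac)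
    then have 1: "(\<lambda>s. f (x + axis j s + axis i (\<tau> n))) field_differentiable (at s)"
      unfolding field_differentiable_def by (auto simp: add_ac)
    have "((\<lambda>s. f (x + axis j s)) has_field_derivative partial_deriv j f (x + axis j s)) (at s)"
      using near0[OF s] r(2) by (intro partial_deriv_along_line[OF diff]) auto
    then have 2: "(\<lambda>s. f (x + axis j s)) field_differentiable (at s)"
      unfolding field_differentiable_def by blast
    show ?thesis unfolding F_def by (intro derivative_intros 1 2 \<tau>)
  qed
  have ulim: "uniform_limit (cball 0 r) F G sequentially"
    unfolding uniform_limit_iff
  proof (intro allI impI)
    fix e :: real assume e: "e > 0"
    then have "e / 2 > 0" by simp
    then obtain d where d: "d > 0" "\<And>y z. y \<in> cball x (2 * r) \<Longrightarrow> z \<in> cball x (2 * r) \<Longrightarrow> dist z y < d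
        \<Longrightarrow> dist (partial_deriv i f z) (partial_deriv i f y) < e / 2"
      using uc by meson
    have "\<forall>\<^sub>F n in sequentially. norm (\<tau> n) < d"
      using tendstoD[OF \<tau>0 d(1)] by simp
    then show "\<forall>\<^sub>F n in sequentially. \<forall>s\<in>cball 0 r. dist (F n s) (G s) < e"
    proof (eventually_elim, intro ballI)
      fix n and s :: complex assume n: "norm (\<tau> n) < d" and s: "s \<in> cball 0 r"
      \<comment> \<open>The mean value inequality for \<open>h\<close> compares the difference
        quotient with \<open>G s\<close>; as \<open>d\<close> comes from uniform continuity, the
        bound is independent of \<open>s\<close>.\<close>
      define h where "h t = f (x + axis j s + axis i t) - t * G s" for t
      have "norm (h (\<tau> n) - h 0) \<le> e / 2 * norm (\<tau> n - 0)"
      proof (rule field_differentiable_bound[of "cball 0 (norm (\<tau> n))"])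
        fix t :: complex assume t: "t \<in> cball 0 (norm (\<tau> n))"
        then have tr: "t \<in> cball 0 r" using \<tau>(2)[of n] by simp
        have "(h has_field_derivative partial_deriv i f (x + axis j s + axis i t) - G s) (at t)"
          unfolding h_def using near[OF s tr] r(2)
          by (auto intro!: derivative_eq_intros partial_deriv_along_line[OF diff])
        then show "(h has_field_derivative partial_deriv i f (x + axis j s + axis i t) - G s)
            (at t within cball 0 (norm (\<tau> n)))"
          by (rule has_field_derivative_at_within)
        have "dist (x + axis j s + axis i t) (x + axis j s) < d"
          using t n by (simp add: dist_norm norm_axis_eq)
        from d(2)[OF near0[OF s] near[OF s tr] this]
        show "norm (partial_deriv i f (x + axis j s + axis i t) - G s) \<le> e / 2"
          by (simp add: G_def dist_norm)
      qed auto
      also have "h (\<tau> n) - h 0 = \<tau> n * (F n s - G s)"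
        using \<tau>(1)[of n] by (simp add: h_def F_def field_simps)
      finally have "norm (\<tau> n) * norm (F n s - G s) \<le> norm (\<tau> n) * (e / 2)"
        by (simp add: norm_mult mult.commute)
      then have "norm (F n s - G s) \<le> e / 2" using \<tau>(1)[of n] by simp
      then show "dist (F n s) (G s) < e" using e by (simp add: dist_norm)
    qed
  qed
  have hol: "\<forall>\<^sub>F n in sequentially. continuous_on (cball 0 r) (F n) \<and> F n holomorphic_on ball 0 r"
    using F' by (intro always_eventually allI conjI holomorphic_onI continuous_at_imp_continuous_on ballI
        field_differentiable_imp_continuous_at) (auto intro: field_differentiable_at_within)
  have "G holomorphic_on ball 0 r"
    by (rule holomorphic_uniform_limit[OF hol ulim]) simp_all
  then have "G field_differentiable at 0"
    using r by (simp add: holomorphic_on_imp_differentiable_at)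
  then show "(\<lambda>t. partial_deriv i f (x + axis j t)) field_differentiable at 0"
    unfolding G_def .
qed

text \<open>Restricting the complex-linear derivative to coordinate lines gives the first partial
  derivatives. The two Cauchy-type lemmas supply their continuity and differentiability, and a
  second use of the first one the continuity of the second derivatives.\<close>

lemma holomorphic_germ_c1_on:
  fixes f :: "complex ^ 'n::finite \<Rightarrow> complex"
  assumes "holomorphic_germ f"
  obtains U where "open U" "0 \<in> U" "c1_on U f" "\<And>i. c1_on U (partial_deriv i f)"
proof -
  obtain U where U: "open U" "0 \<in> U"
    and D: "\<And>x. x \<in> U \<Longrightarrow> \<exists>D. (f has_derivative D) (at x) \<and> (\<forall>c h. D (c *s h) = c * D h)"
    using assms unfolding holomorphic_germ_def by blast
  have cont: "continuous_on U f"
    using D has_derivative_continuous by (blast intro: continuous_at_imp_continuous_on)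
  have diff: "partially_differentiable_on U f"
    unfolding partially_differentiable_on_def
  proof (intro ballI allI)
    fix x i assume "x \<in> U"
    then obtain D where D: "(f has_derivative D) (at (x + axis i 0))" "\<And>c h. D (c *s h) = c * D h"
      using D by (metis add.right_neutral axis_eq_0_iff)
    have "((\<lambda>t. x + axis i t) has_derivative (\<lambda>t. 0 + axis i t)) (at 0)"
      by (intro has_derivative_add has_derivative_const bounded_linear_imp_has_derivative bounded_linear_axis)
    from has_derivative_compose[OF this D(1)]
    have "((\<lambda>t. f (x + axis i t)) has_derivative (\<lambda>t. D (axis i t))) (at 0)" by simp
    \<comment> \<open>Complex homogeneity turns this real-linear map into multiplication by a
      complex number, that is, a complex derivative.\<close>
    moreover have "(\<lambda>t. D (axis i t)) = (*) (D (axis i 1))"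
    proof
      fix t :: complex
      have "axis i t = t *s axis i 1" by (simp add: axis_def vec_eq_iff)
      then show "D (axis i t) = D (axis i 1) * t" using D(2)[of t "axis i 1"] by simp
    qed
    ultimately show "(\<lambda>t. f (x + axis i t)) field_differentiable at 0"
      unfolding field_differentiable_def has_field_derivative_def by metis
  qed
  have cont': "continuous_on U (partial_deriv i f)" for i
    by (rule continuous_on_partial_deriv[OF U(1) cont diff])
  have diff': "partially_differentiable_on U (partial_deriv i f)" for i
    by (rule partially_differentiable_on_partial_deriv[OF U(1) cont diff])
  show thesis
    by (rule that[OF U])
       (simp_all add: c1_on_def diff cont' diff' continuous_on_partial_deriv[OF U(1) cont' diff'])
qed

text \<open>A complex subspace isomorphic to a proper complex subspace of \<open>T\<close> has smaller real dimension than \<open>T\<close>.\<close>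

lemma vec_dim_le_if_dim_le:
  fixes S T :: "(complex ^ 'n::finite) set"
  assumes S: "vec.subspace S" and T: "vec.subspace T" and le: "dim T \<le> dim S"
  shows "vec.dim T \<le> vec.dim S"
proof (rule ccontr)
  assume "\<not> vec.dim T \<le> vec.dim S"
  then have lt: "vec.dim S < vec.dim T" by simp
  have scaleR: "c *\<^sub>R x = complex_of_real c *s x" for c and x :: "complex ^ 'n"
    by (simp add: vec_eq_iff scaleR_conv_of_real[where 'a = complex])
  then have real_subspace: "subspace A" if "vec.subspace A" for A :: "(complex ^ 'n) set"
    using that by (simp add: subspace_def vec.subspace_def)
  \<comment> \<open>\<open>T'\<close> is to be a copy of \<open>S\<close> inside \<open>T\<close>:
    the complex isomorphism \<open>h\<close> is also real-linear, so \<open>T'\<close> and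
    \<open>S\<close> have the same real dimension.\<close>
  obtain T' where T': "vec.subspace T'" "T' \<subseteq> T" "vec.dim T' = vec.dim S"
    using vec.choose_subspace_of_subspace[OF less_imp_le[OF lt]] T by (metis vec.span_eq_iff)
  obtain h where h: "Vector_Spaces.linear (*s) (*s) h" "h ` S = T'" "inj_on h S"
    using vec.subspace_isomorphism[OF S T'(1)] T'(3) by metis
  have "linear h"
    by (rule linearI) (simp_all add: scaleR vec.linear_add[OF h(1)] vec.linear_scale[OF h(1)])
  moreover have "inj_on h (span S)" using h(3) by (simp add: span_eq_iff[THEN iffD2, OF real_subspace[OF S]])
  ultimately have "dim T' = dim S" using dim_image_eq[of h S] h(2) by simp
  \<comment> \<open>By \<open>le\<close> the real dimension of \<open>T'\<close> is at least that of
    \<open>T\<close>, so \<open>T'\<close> fills \<open>T\<close>, against the strict inequality of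
    complex dimensions.\<close>
  then have "T' = T"
    using le by (intro subspace_dim_equal real_subspace T T') simp
  then show False using T' lt by simp
qed

section \<open>Equality of coranks for real and for holomorphic germs\<close>

theorem theorem4p7:
  shows "(\<forall>f g :: real ^ 'n::finite \<Rightarrow> real.
            smooth_germ f \<and> f 0 = 0 \<and> finitely_determined smooth_germ f \<and>
            smooth_germ g \<and> g 0 = 0 \<and> finitely_determined smooth_germ g \<and>
            critical_at_0 f \<and> bilipschitz_equivalent f g
            \<longrightarrow> corank f = corank g) \<and>
         (\<forall>f g :: complex ^ 'n \<Rightarrow> complex.
            holomorphic_germ f \<and> f 0 = 0 \<and> finitely_determined holomorphic_germ f \<and>
            holomorphic_germ g \<and> g 0 = 0 \<and> finitely_determined holomorphic_germ g \<and>
            critical_at_0 f \<and> bilipschitz_equivalent f g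
            \<longrightarrow> corank f = corank g)"
proof (intro conjI allI impI; elim conjE)
  fix f g :: "real ^ 'n \<Rightarrow> real"
  assume *: "f 0 = 0" "g 0 = 0" "critical_at_0 f" "bilipschitz_equivalent f g"
  assume "smooth_germ f"
  then obtain U where "open U" "0 \<in> U" "c1_on U f" "\<And>i. c1_on U (partial_deriv i f)"
    by (rule smooth_germ_c1_on) (rule that)
  note f = this
  assume "smooth_germ g"
  then obtain V where "open V" "0 \<in> V" "c1_on V g" "\<And>i. c1_on V (partial_deriv i g)"
    by (rule smooth_germ_c1_on) (rule that)
  \<comment> \<open>Over the reals \<open>vec.dim\<close> coincides with \<open>dim\<close>.\<close>
  from dim_hessian_kernel_eq[OF f *(1,3) this *(2,4)] show "corank f = corank g"
    by (simp add: corank_def dim_vec_eq)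
next
  fix f g :: "complex ^ 'n \<Rightarrow> complex"
  assume *: "f 0 = 0" "g 0 = 0" "critical_at_0 f" "bilipschitz_equivalent f g"
  assume "holomorphic_germ f"
  then obtain U where "open U" "0 \<in> U" "c1_on U f" "\<And>i. c1_on U (partial_deriv i f)"
    by (rule holomorphic_germ_c1_on) (rule that)
  note f = this
  assume "holomorphic_germ g"
  then obtain V where "open V" "0 \<in> V" "c1_on V g" "\<And>i. c1_on V (partial_deriv i g)"
    by (rule holomorphic_germ_c1_on) (rule that)
  from dim_hessian_kernel_eq[OF f *(1,3) this *(2,4)]
  have "dim {v. hessian f *v v = 0} = dim {v. hessian g *v v = 0}" .
  \<comment> \<open>The kernels are complex subspaces, so equality of real dimensions yields both
    inequalities between the complex ones.\<close>
  moreover have "vec.subspace {v. hessian h *v v = 0}" for h :: "complex ^ 'n \<Rightarrow> complex"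
    by (simp add: vec.subspace_def matrix_vector_right_distrib vector_scalar_commute)
  ultimately show "corank f = corank g"
    unfolding corank_def by (intro antisym vec_dim_le_if_dim_le) simp_all
qed

end
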